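(* Let $\mathcal M=(K_{i(e)},w_e,p_e)_{e\in E}$ be a uniformly continuous Markov system on a complete metric space $(K,d)$. Let $M\in P_S(\Sigma)$ and let $M=\int\Lambda_\omega\,dM(\omega)$ be its ergodic decomposition. (i) If $M\in E(\mathcal M)$, then $\Lambda_\omega\in E(\mathcal M)$ for $M$-a.e. $\omega\in\Sigma$. (ii) If $M\in\tilde E(\mathcal M)$, then $\Lambda_\omega\in\tilde E(\mathcal M)$ for $M$-a.e. $\omega\in\Sigma$.
   Context: Markov system. A Markov system $\mathcal M=(K_{i(e)},w_e,p_e)_{e\in E}$ on a complete metric space $(K,d)$ consists of: an at most countable set $E$; Borel measurable maps $w_e:K\to K$ and Borel measurable functions $p_e:K\to[0,1]$ ($e\in E$) with $\sum_{e\in E}p_e(x)=1$ for all $x\in K$; a partition $(K_i)_{i\in N}$ of $K$ into non-empty Borel sets; and maps $i,t:E\to N$, with $i$ surjective (so $N$ is at most countable), such that $\emptyset\neq\{p_e>0\}\subset K_{i(e)}$ and $w_e(K_{i(e)})\subset K_{t(e)}$ for all $e\in E$. It is uniformly continuous if $w_e|_{K_{i(e)}}$ and $p_e|_{K_{i(e)}}$ are uniformly continuous for all $e$. Code space. $\bar E:=E\cup\{\infty\}$ is the one-point compactification of the discrete space $E$; $w_\infty:=\mathrm{id}$, $p_\infty:=0$, $i(\infty)=t(\infty)=n_\infty$ for a fixed $n_\infty\in N$. $\Sigma:=\bar E^{\mathbb Z}$ with the product topology and Borel $\sigma$-algebra $\mathcal B(\Sigma)$; ${}_m[e_m,\dots,e_n]=\{\sigma\in\Sigma:\sigma_i=e_i,\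 m\le i\le n\}$. $S$ is the left shift, $(S\sigma)_{i-1}=\sigma_i$; $P_S(\Sigma)$ is the set of $S$-invariant Borel probability measures on $\Sigma$. $\mathcal F$ is the $\sigma$-algebra generated by all cylinders ${}_m[e_m,\dots,e_0]$, $m\le0$. $\Sigma_G:=\{\sigma\in\Sigma:\sigma_n\in E,\ i(\sigma_{n+1})=t(\sigma_n)\ \forall n\in\mathbb Z\}$. Coding map, $E(\mathcal M)$, $\tilde E(\mathcal M)$. Fix $x_i\in K_i$ for each $i\in N$. $D:=\{\sigma\in\Sigma_G:\lim_{m\to-\infty}w_{\sigma_0}\circ w_{\sigma_{-1}}\circ\cdots\circ w_{\sigma_m}(x_{i(\sigma_m)})\text{ exists}\}$. The coding map $F:\Sigma\to K$ is $F(\sigma):=$ this limit if $\sigma\in D$, and $F(\sigma):=x_{t(\sigma_0)}$ otherwise. $E(\mathcal M):=\{\Lambda\in P_S(\Sigma):\Lambda(D)=1$ and $E_\Lambda(1_{{}_1[e]}|\mathcal F)=p_e\circ F$ $\Lambda$-a.e. for all $e\in E\}$. Let $T_j:=\{\sigma\in\Sigma_G:t(\sigma_0)=j\}$, and let $\bar p_e$ be the continuous extension of $p_e|_{K_{i(e)}}$ to the closure $\bar K_{i(e)}$, extended by $0$ to $K$. $\tilde E(\mathcal M):=\{\Lambda\in P_S(\Sigma):\Lambda(D)=1$ and $E_\Lambda(1_{{}_1[e]}|\mathcal F)=(\bar p_e\circ F)1_{T_{i(e)}}$ $\Lambda$-a.e. for all $e\in E\}$. Ergodic decomposition. For $M\in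 P_S(\Sigma)$ let $\mathcal I_M:=\{B\in\mathcal B(\Sigma):M(S^{-1}B\,\Delta\,B)=0\}$, a $\sigma$-algebra. The ergodic decomposition of $M$, written $M=\int\Lambda_\omega\,dM(\omega)$, is the family $(\Lambda_\omega)_{\omega\in\Sigma}$ in $P_S(\Sigma)$ (which exists and is $M$-a.s. unique) such that: for every $f\in\mathcal L^1(M)$, $\omega\mapsto\int f\,d\Lambda_\omega$ is $\mathcal I_M$-measurable and $\int f\,d\Lambda_\omega=E_M(f|\mathcal I_M)(\omega)$ for $M$-a.e. $\omega$; $\Lambda_{S\omega}=\Lambda_\omega$ for all $\omega$; and $\Lambda_\omega$ is ergodic for all $\omega$. *)

theory Defs
  imports "HOL-Probability.Probability"
begin

text \<open>
  The complete metric space, the countable index set of the maps and the index set of the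
  partition are the types \<open>'k\<close>, \<open>'e\<close> and \<open>'n\<close>.
\<close>

record ('k, 'e, 'n) msys =
  cell :: "'n \<Rightarrow> 'k set"
  wmap :: "'e \<Rightarrow> 'k \<Rightarrow> 'k"
  wprob :: "'e \<Rightarrow> 'k \<Rightarrow> real"
  isrc :: "'e \<Rightarrow> 'n"
  itgt :: "'e \<Rightarrow> 'n"

locale markov_system =
  fixes Q :: "('k::complete_space, 'e::countable, 'n) msys"
  assumes wmap_measurable: "wmap Q e \<in> borel_measurable borel"
    and wprob_measurable: "wprob Q e \<in> borel_measurable borel"
    and wprob_range: "wprob Q e y \<in> {0..1}"
    and wprob_sum: "((\<lambda>e. wprob Q e y) has_sum 1) UNIV"
    and cell_borel: "cell Q i \<in> sets borel"
    and cell_nonempty: "cell Q i \<noteq> {}"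
    and cell_disjoint: "disjoint_family (cell Q)"
    and cell_cover: "(\<Union>i. cell Q i) = UNIV"
    and isrc_surj: "surj (isrc Q)"
    and wprob_nonzero: "{y. wprob Q e y > 0} \<noteq> {}"
    and wprob_support: "{y. wprob Q e y > 0} \<subseteq> cell Q (isrc Q e)"
    and wmap_cell: "wmap Q e ` cell Q (isrc Q e) \<subseteq> cell Q (itgt Q e)"

locale unif_cont_markov_system = markov_system +
  assumes wmap_unif_cont: "uniformly_continuous_on (cell Q (isrc Q e)) (wmap Q e)"
    and wprob_unif_cont: "uniformly_continuous_on (cell Q (isrc Q e)) (wprob Q e)"

text \<open>\<open>None\<close> is the point at infinity of the one-point compactification of \<open>'e\<close>.\<close>

type_synonym 'e code = "int \<Rightarrow> 'e option"

definition code_top :: "'e code topology" where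
  "code_top = product_topology (\<lambda>_. Alexandroff_compactification (discrete_topology UNIV)) UNIV"

definition code_borel :: "'e code measure" where
  "code_borel = sigma UNIV {U. openin code_top U}"

definition cylinder :: "int \<Rightarrow> int \<Rightarrow> 'e code \<Rightarrow> 'e code set" where
  "cylinder m n c = {\<sigma>. \<forall>k\<in>{m..n}. \<sigma> k = c k}"

definition shift :: "'e code \<Rightarrow> 'e code" where
  "shift \<sigma> = (\<lambda>k. \<sigma> (k + 1))"

definition shift_invariant :: "'e code measure set" where
  "shift_invariant = {M. prob_space M \<and> sets M = sets code_borel \<and> distr M M shift = M}"

definition past_algebra :: "'e code measure" where
  "past_algebra = sigma UNIV {cylinder m 0 c | m c. m \<le> 0}"

text \<open>Extensions of the data to infinity; \<open>n\<close> plays the role of the vertex \<open>n\<^sub>\<infinity>\<close>.\<close>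

definition src_ext :: "('k, 'e, 'n) msys \<Rightarrow> 'n \<Rightarrow> 'e option \<Rightarrow> 'n" where
  "src_ext Q n e = (case e of None \<Rightarrow> n | Some e \<Rightarrow> isrc Q e)"

definition tgt_ext :: "('k, 'e, 'n) msys \<Rightarrow> 'n \<Rightarrow> 'e option \<Rightarrow> 'n" where
  "tgt_ext Q n e = (case e of None \<Rightarrow> n | Some e \<Rightarrow> itgt Q e)"

definition wmap_ext :: "('k, 'e, 'n) msys \<Rightarrow> 'e option \<Rightarrow> 'k \<Rightarrow> 'k" where
  "wmap_ext Q e = (case e of None \<Rightarrow> id | Some e \<Rightarrow> wmap Q e)"

definition path_space :: "('k, 'e, 'n) msys \<Rightarrow> 'n \<Rightarrow> 'e code set" where
  "path_space Q n =
    {\<sigma>. \<forall>k. \<sigma> k \<noteq> None \<and> src_ext Q n (\<sigma> (k + 1)) = tgt_ext Q n (\<sigma> k)}"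

text \<open>\<open>past_comp Q \<sigma> j\<close> is \<open>w\<^bsub>\<sigma>(0)\<^esub> \<circ> w\<^bsub>\<sigma>(-1)\<^esub> \<circ> \<dots> \<circ> w\<^bsub>\<sigma>(-j)\<^esub>\<close>.\<close>

primrec past_comp :: "('k, 'e, 'n) msys \<Rightarrow> 'e code \<Rightarrow> nat \<Rightarrow> 'k \<Rightarrow> 'k" where
  "past_comp Q \<sigma> 0 = wmap_ext Q (\<sigma> 0)"
| "past_comp Q \<sigma> (Suc j) = past_comp Q \<sigma> j \<circ> wmap_ext Q (\<sigma> (- int (Suc j)))"

definition past_point :: "('k, 'e, 'n) msys \<Rightarrow> 'n \<Rightarrow> ('n \<Rightarrow> 'k) \<Rightarrow> 'e code \<Rightarrow> nat \<Rightarrow> 'k" where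
  "past_point Q n x \<sigma> j = past_comp Q \<sigma> j (x (src_ext Q n (\<sigma> (- int j))))"

definition coding_dom ::
    "('k::metric_space, 'e, 'n) msys \<Rightarrow> 'n \<Rightarrow> ('n \<Rightarrow> 'k) \<Rightarrow> 'e code set" where
  "coding_dom Q n x = {\<sigma> \<in> path_space Q n. convergent (past_point Q n x \<sigma>)}"

definition coding_map ::
    "('k::metric_space, 'e, 'n) msys \<Rightarrow> 'n \<Rightarrow> ('n \<Rightarrow> 'k) \<Rightarrow> 'e code \<Rightarrow> 'k" where
  "coding_map Q n x \<sigma> =
    (if \<sigma> \<in> coding_dom Q n x then lim (past_point Q n x \<sigma>) else x (tgt_ext Q n (\<sigma> 0)))"

definition coding_measures ::
    "('k::metric_space, 'e, 'n) msys \<Rightarrow> 'n \<Rightarrow> ('n \<Rightarrow> 'k) \<Rightarrow> 'e code measure set" where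
  "coding_measures Q n x =
    {L \<in> shift_invariant. measure L (coding_dom Q n x) = 1 \<and>
      (\<forall>e. AE \<sigma> in L.
        real_cond_exp L past_algebra (indicator (cylinder 1 1 (\<lambda>_. Some e))) \<sigma> =
        wprob Q e (coding_map Q n x \<sigma>))}"

definition ends_at :: "('k, 'e, 'n) msys \<Rightarrow> 'n \<Rightarrow> 'n \<Rightarrow> 'e code set" where
  "ends_at Q n j = {\<sigma> \<in> path_space Q n. tgt_ext Q n (\<sigma> 0) = j}"

text \<open>The choice is unique on the closure, where alone its value is used.\<close>

definition wprob_closure :: "('k::metric_space, 'e, 'n) msys \<Rightarrow> 'e \<Rightarrow> 'k \<Rightarrow> real" where
  "wprob_closure Q e y =
    (let A = cell Q (isrc Q e) in
      if y \<in> closure A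
      then (SOME g. continuous_on (closure A) g \<and> (\<forall>z\<in>A. g z = wprob Q e z)) y
      else 0)"

definition coding_measures_closure ::
    "('k::metric_space, 'e, 'n) msys \<Rightarrow> 'n \<Rightarrow> ('n \<Rightarrow> 'k) \<Rightarrow> 'e code measure set" where
  "coding_measures_closure Q n x =
    {L \<in> shift_invariant. measure L (coding_dom Q n x) = 1 \<and>
      (\<forall>e. AE \<sigma> in L.
        real_cond_exp L past_algebra (indicator (cylinder 1 1 (\<lambda>_. Some e))) \<sigma> =
        wprob_closure Q e (coding_map Q n x \<sigma>) * indicator (ends_at Q n (isrc Q e)) \<sigma>)}"

definition ergodic :: "'e code measure \<Rightarrow> bool" where
  "ergodic L \<longleftrightarrow> L \<in> shift_invariant \<and>
    (\<forall>B\<in>sets L. shift -` B = B \<longrightarrow> measure L B \<in> {0, 1})"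

definition invariant_algebra :: "'e code measure \<Rightarrow> 'e code measure" where
  "invariant_algebra M =
    sigma UNIV {B \<in> sets code_borel. emeasure M (sym_diff (shift -` B) B) = 0}"

definition ergodic_decomposition ::
    "'e code measure \<Rightarrow> ('e code \<Rightarrow> 'e code measure) \<Rightarrow> bool" where
  "ergodic_decomposition M L \<longleftrightarrow>
    (\<forall>f :: 'e code \<Rightarrow> real. integrable M f \<longrightarrow>
      (\<lambda>\<omega>. \<integral>\<sigma>. f \<sigma> \<partial>L \<omega>) \<in> borel_measurable (invariant_algebra M) \<and>
      (AE \<omega> in M. (\<integral>\<sigma>. f \<sigma> \<partial>L \<omega>) = real_cond_exp M (invariant_algebra M) f \<omega>)) \<and>
    (\<forall>\<omega>. L (shift \<omega>) = L \<omega>) \<and>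
    (\<forall>\<omega>. ergodic (L \<omega>))"

end

theory Submission
  imports Defs
begin

text \<open>
  Up to null sets, the coding map depends on the past coordinates only, so membership in
  \<open>E(M)\<close> amounts to \<open>\<integral>\<^sub>A h d\<Lambda> = 0\<close> for \<open>h = 1\<^bsub>[e]\<^esub> - p\<^sub>e \<circ> F\<close> and all past cylinders \<open>A\<close>, of
  which there are only countably many. By shift invariance, a set invariant modulo \<open>M\<close> can be
  approximated by sets in the past \<open>\<sigma>\<close>-algebra; hence \<open>\<integral>\<^sub>B 1\<^sub>A h dM = 0\<close> for every invariant
  \<open>B\<close>, so that \<open>\<integral>\<^sub>A h d\<Lambda>\<^sub>\<omega> = E(1\<^sub>A h | \<I>)(\<omega>) = 0\<close> for almost every \<open>\<omega>\<close>.
\<close>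

section \<open>Measurability on the code space\<close>

text \<open>Two obstacles shape the argument. An ergodic component may be singular to
  \<open>M\<close>, and \<open>real_cond_exp\<close> selects its version for each measure
  separately. So an identity that holds \<open>M\<close>-almost everywhere says nothing by itself
  about a component; it has to pass through integrals, which the decomposition does control, and be
  rebuilt there. The second obstacle is that membership in \<open>coding_dom\<close> is decided by
  all coordinates, since the whole bilateral path must be admissible. The right-hand sides are
  therefore exchanged for past-measurable ones before the transfer and restored afterwards. Both
  exchanges happen on \<open>coding_dom\<close>, so this set must first be shown to have full
  measure for almost every component as well. In the second class the right-hand side contains a
  chosen extension of \<open>wprob\<close>; uniform continuity guarantees that such an extension
  exists, and its values stay in [0,1] by continuity. After that both classes are instances of one
  transfer lemma.\<close>

lemma space_code_borel [simp]: "space code_borel = UNIV"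
  by (simp add: code_borel_def)

lemma space_past_algebra [simp]: "space past_algebra = UNIV"
  by (simp add: past_algebra_def)

text \<open>A set of letters that avoids infinity is open in the compactification of a discrete
  space, and a set that contains infinity is the complement of such a set. Hence every set of
  letters has a Borel preimage.\<close>

lemma coord_code_borel [measurable]:
  "(\<lambda>\<sigma>. \<sigma> k) \<in> measurable code_borel (count_space UNIV)"
proof -
  have op: "{\<sigma>. \<sigma> k \<in> Some ` W} \<in> sets code_borel" for W :: "'a set"
  proof -
    have "continuous_map code_top (Alexandroff_compactification (discrete_topology UNIV)) (\<lambda>\<sigma> :: 'a code. \<sigma> k)"
      unfolding code_top_def by (rule continuous_map_product_projection) simp
    moreover have "openin (Alexandroff_compactification (discrete_topology UNIV)) (Some ` W)"
      by simp
    ultimately have "openin code_top {\<sigma> \<in> topspace code_top. \<sigma> k \<in> Some ` W}"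
      by (rule openin_continuous_map_preimage)
    moreover have "topspace code_top = (UNIV :: 'a code set)"
      by (simp add: code_top_def flip: UNIV_option_conv)
    ultimately show ?thesis
      by (simp add: code_borel_def)
  qed
  have img: "A = Some ` (Some -` A)" if "None \<notin> A" for A :: "'a option set"
  proof -
    have "b \<in> Some ` (Some -` A)" if "b \<in> A" for b
      using that \<open>None \<notin> A\<close> by (cases b) auto
    then show ?thesis by blast
  qed
  show ?thesis
  proof (rule measurableI)
    fix A :: "'a option set"
    show "(\<lambda>\<sigma>. \<sigma> k) -` A \<inter> space code_borel \<in> sets code_borel"
    proof (cases "None \<in> A")
      case False
      have "(\<lambda>\<sigma>. \<sigma> k) -` A \<inter> space code_borel = {\<sigma>. \<sigma> k \<in> Some ` (Some -` A)}"
        unfolding img[OF False, symmetric] by auto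
      then show ?thesis
        using op by (simp only:)
    next
      case True
      then have "None \<notin> - A" by simp
      have "(\<lambda>\<sigma>. \<sigma> k) -` A \<inter> space code_borel = space code_borel - {\<sigma>. \<sigma> k \<in> Some ` (Some -` (- A))}"
        unfolding img[OF \<open>None \<notin> - A\<close>, symmetric] by auto
      then show ?thesis
        using op by (simp only: sets.compl_sets)
    qed
  qed simp
qed

text \<open>A base of the topology: compact sets of a discrete space are finite, so the
  neighbourhoods of infinity are exactly the sets that omit finitely many letters.\<close>

definition compactification_base :: "'e option set set" where
  "compactification_base = range (\<lambda>e. {Some e}) \<union> (\<lambda>F. insert None (Some ` (- F))) ` {F. finite F}"

lemma countable_compactification_base:
  "countable (compactification_base :: 'e::countable option set set)"
proof -
  have "countable {F :: 'e set. finite F}"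
    using countable_Collect_finite_subset[of "UNIV :: 'e set"] by simp
  then show ?thesis
    by (simp add: compactification_base_def)
qed

lemma compactification_baseE:
  assumes "openin (Alexandroff_compactification (discrete_topology UNIV)) U" "a \<in> U"
  obtains V where "V \<in> compactification_base" "a \<in> V" "V \<subseteq> U"
proof (cases a)
  case None
  with assms obtain C where "compactin (discrete_topology UNIV) C" "U = insert None (Some ` (- C))"
    by (auto simp: openin_Alexandroff_compactification Compl_eq_Diff_UNIV)
  then show ?thesis
    using None by (intro that[of U]) (auto simp: compactification_base_def compactin_discrete_topology)
next
  case (Some e)
  then show ?thesis
    using assms by (intro that[of "{Some e}"]) (auto simp: compactification_base_def)
qed

text \<open>Keeping the constraints as a set of pairs makes it visible that finitely many
  constraints from a countable base give only countably many boxes.\<close>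

definition coord_box :: "(int \<times> 'e option set) set \<Rightarrow> 'e code set" where
  "coord_box P = {\<tau>. \<forall>(k, V)\<in>P. \<tau> k \<in> V}"

text \<open>Second countability makes the Borel sets of the code space the product \<open>\<sigma>\<close>-algebra.\<close>

lemma measurable_code_borelI:
  fixes f :: "'a \<Rightarrow> 'e::countable code"
  assumes f: "\<And>k. (\<lambda>\<omega>. f \<omega> k) \<in> measurable N (count_space UNIV)"
  shows "f \<in> measurable N code_borel"
  unfolding code_borel_def
proof (rule measurable_measure_of)
  fix U :: "'e code set" assume "U \<in> {U. openin code_top U}"
  then have U: "openin code_top U" by simp
  define \<B> where "\<B> = {coord_box P | P :: (int \<times> 'e option set) set.
    finite P \<and> P \<subseteq> UNIV \<times> compactification_base \<and> coord_box P \<subseteq> U}"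
  have "countable {P :: (int \<times> 'e option set) set. finite P \<and> P \<subseteq> UNIV \<times> compactification_base}"
    by (intro countable_Collect_finite_subset countable_SIGMA countable_compactification_base) auto
  then have "countable (coord_box ` {P :: (int \<times> 'e option set) set. finite P \<and> P \<subseteq> UNIV \<times> compactification_base})"
    by simp
  then have cB: "countable \<B>"
    by (rule countable_subset[rotated]) (auto simp: \<B>_def)
  have "U \<subseteq> \<Union>\<B>"
  proof
    fix \<sigma> assume \<sigma>: "\<sigma> \<in> U"
    have "\<exists>W. finite {k \<in> UNIV. W k \<noteq> topspace (Alexandroff_compactification (discrete_topology UNIV))} \<and>
        (\<forall>k\<in>UNIV. openin (Alexandroff_compactification (discrete_topology (UNIV :: 'e set))) (W k)) \<and>
        \<sigma> \<in> Pi\<^sub>E UNIV W \<and> Pi\<^sub>E UNIV W \<subseteq> U"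
      using U \<sigma> unfolding code_top_def openin_product_topology_alt by blast
    moreover have "topspace (Alexandroff_compactification (discrete_topology (UNIV :: 'e set))) = UNIV"
      by (simp flip: UNIV_option_conv)
    ultimately obtain W where W: "finite {k. W k \<noteq> (UNIV :: 'e option set)}"
      "\<And>k. openin (Alexandroff_compactification (discrete_topology UNIV)) (W k)"
      "\<sigma> \<in> Pi\<^sub>E UNIV W" "Pi\<^sub>E UNIV W \<subseteq> U"
      by (metis (mono_tags, lifting) Collect_cong UNIV_I)
    have "\<forall>k. \<exists>V. V \<in> compactification_base \<and> \<sigma> k \<in> V \<and> V \<subseteq> W k"
    proof
      fix k
      have "\<sigma> k \<in> W k" using W(3) by auto
      then show "\<exists>V. V \<in> compactification_base \<and> \<sigma> k \<in> V \<and> V \<subseteq> W k"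
        by (rule compactification_baseE[OF W(2)]) blast
    qed
    then obtain V where V: "\<And>k. V k \<in> compactification_base" "\<And>k. \<sigma> k \<in> V k" "\<And>k. V k \<subseteq> W k"
      by metis
    \<comment> \<open>Only coordinates that \<open>W\<close> really restricts are recorded, so
      \<open>?P\<close> is finite; replacing \<open>W k\<close> by a smaller member of the base puts
      the box into the countable family.\<close>
    let ?P = "(\<lambda>k. (k, V k)) ` {k. W k \<noteq> UNIV}"
    have "\<sigma> \<in> coord_box ?P"
      using V by (auto simp: coord_box_def)
    moreover have "coord_box ?P \<subseteq> Pi\<^sub>E UNIV W"
    proof
      fix \<tau> assume "\<tau> \<in> coord_box ?P"
      then have "\<tau> k \<in> W k" for k
        using V(3)[of k] by (cases "W k = UNIV") (auto simp: coord_box_def)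
      then show "\<tau> \<in> Pi\<^sub>E UNIV W" by auto
    qed
    ultimately show "\<sigma> \<in> \<Union>\<B>"
    proof (intro UnionI)
      have "finite ?P"
        using W(1) by (rule finite_imageI)
      moreover have "?P \<subseteq> UNIV \<times> compactification_base"
        using V(1) by blast
      moreover have "coord_box ?P \<subseteq> U"
        using \<open>coord_box ?P \<subseteq> Pi\<^sub>E UNIV W\<close> W(4) by (rule order_trans)
      ultimately show "coord_box ?P \<in> \<B>"
        unfolding \<B>_def by blast
    qed
  qed
  then have "U = \<Union>\<B>" by (auto simp: \<B>_def)
  then have eq: "f -` U \<inter> space N = (\<Union>B\<in>\<B>. f -` B \<inter> space N)" by blast
  have "f -` coord_box P \<inter> space N \<in> sets N" if "finite P" for P
  proof -
    have "f -` coord_box P \<inter> space N = {\<omega> \<in> space N. \<forall>p\<in>P. f \<omega> (fst p) \<in> snd p}"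
      by (auto simp: coord_box_def)
    also have "\<dots> \<in> sets N"
      using that measurable_sets[OF f]
      by (intro sets.sets_Collect_finite_All) (auto simp: vimage_def Int_def conj_commute)
    finally show ?thesis .
  qed
  then show "f -` U \<inter> space N \<in> sets N"
    unfolding eq using cB by (intro sets.countable_UN') (auto simp: \<B>_def)
qed auto

lemma measurable_past_algebraI:
  assumes f: "\<And>k. k \<le> 0 \<Longrightarrow> (\<lambda>\<omega>. f \<omega> k) \<in> measurable N (count_space UNIV)"
  shows "f \<in> measurable N past_algebra"
  unfolding past_algebra_def
proof (rule measurable_measure_of, goal_cases)
  case (3 A)
  then obtain m c where A: "A = cylinder m 0 c" by auto
  have "f -` A \<inter> space N = {\<omega> \<in> space N. \<forall>k\<in>{m..0}. f \<omega> k = c k}"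
    by (auto simp: A cylinder_def)
  also have "\<dots> \<in> sets N"
    using measurable_sets[OF f, of _ "{c _}"]
    by (intro sets.sets_Collect_finite_All) (auto simp: vimage_def Int_def conj_commute)
  finally show ?case .
qed auto

text \<open>\<open>f\<close> factors through the restriction to \<open>J\<close>, which takes
  countably many values. A preimage is thus a countable union of fibres of that restriction,
  whatever the target space is.\<close>

lemma measurable_finite_coordinates:
  fixes f :: "'e::countable code \<Rightarrow> 'b"
  assumes J: "finite J" and coord: "\<And>k. k \<in> J \<Longrightarrow> (\<lambda>\<sigma>. \<sigma> k) \<in> measurable N (count_space UNIV)"
    and N: "space N = UNIV"
    and f: "\<And>\<sigma> \<tau>. (\<And>k. k \<in> J \<Longrightarrow> \<sigma> k = \<tau> k) \<Longrightarrow> f \<sigma> = f \<tau>" and R: "\<And>\<sigma>. f \<sigma> \<in> space R"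
  shows "f \<in> measurable N R"
proof (rule measurableI)
  fix A assume "A \<in> sets R"
  let ?C = "\<lambda>c. {\<sigma> \<in> space N. \<forall>k\<in>J. \<sigma> k = c k}"
  let ?X = "(\<lambda>\<sigma>. restrict \<sigma> J) ` (f -` A)"
  have "f -` A \<inter> space N = (\<Union>c\<in>?X. ?C c)"
  proof (intro equalityI subsetI)
    fix \<sigma> assume "\<sigma> \<in> f -` A \<inter> space N"
    then show "\<sigma> \<in> (\<Union>c\<in>?X. ?C c)"
      by (intro UN_I[of "restrict \<sigma> J"] imageI) auto
  next
    fix \<sigma> assume "\<sigma> \<in> (\<Union>c\<in>?X. ?C c)"
    then obtain \<tau> where "f \<tau> \<in> A" "\<And>k. k \<in> J \<Longrightarrow> \<sigma> k = \<tau> k"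
      by auto
    then show "\<sigma> \<in> f -` A \<inter> space N"
      using f[of \<sigma> \<tau>] N by simp
  qed
  moreover have "countable ?X"
    by (rule countable_subset[OF _ countable_PiE[OF J, of "\<lambda>_. UNIV"]]) auto
  moreover have "?C c \<in> sets N" for c
    using measurable_sets[OF coord, of _ "{c _}"] J
    by (intro sets.sets_Collect_finite_All) (auto simp: vimage_def Int_def conj_commute)
  ultimately show "f -` A \<inter> space N \<in> sets N"
    by (simp only:) (rule sets.countable_UN', auto)
qed (use R in auto)

lemma countable_cylinders_until_0:
  "countable {cylinder m 0 c | m (c :: 'e::countable code). m \<le> 0}"
proof -
  have sub: "{cylinder m 0 c | m (c :: 'e code). m \<le> 0}
      \<subseteq> (\<Union>m. (cylinder m 0) ` (PiE {m..0} (\<lambda>_. UNIV :: 'e option set)))"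
  proof
    fix A assume "A \<in> {cylinder m 0 c | m (c :: 'e code). m \<le> 0}"
    then obtain m and c :: "'e code" where "A = cylinder m 0 c"
      by blast
    then have "A = cylinder m 0 (restrict c {m..0})"
      by (simp add: cylinder_def)
    moreover have "restrict c {m..0} \<in> PiE {m..0} (\<lambda>_. UNIV)"
      by simp
    ultimately show "A \<in> (\<Union>m. (cylinder m 0) ` (PiE {m..0} (\<lambda>_. UNIV)))"
      by (rule UN_I[where a = m, OF UNIV_I image_eqI])
  qed
  have "countable (PiE {m..0} (\<lambda>_. UNIV :: 'e option set))" for m :: int
    by (rule countable_PiE) simp_all
  then show ?thesis
    by (intro countable_subset[OF sub] countable_UN countable_image) simp
qed

text \<open>The preimage is a union of cylinders indexed by uncountably many codes, but among these
  cylinders only countably many are distinct.\<close>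

lemma coord_past_algebra:
  fixes k :: int
  assumes "k \<le> 0"
  shows "(\<lambda>\<sigma> :: 'e::countable code. \<sigma> k) \<in> measurable past_algebra (count_space UNIV)"
proof (rule measurableI)
  fix A :: "'e option set"
  let ?X = "{cylinder k 0 c | c. c k \<in> A}"
  have "(\<lambda>\<sigma> :: 'e code. \<sigma> k) -` A \<inter> space past_algebra = \<Union>?X"
    using assms by (auto simp: cylinder_def)
  moreover have "?X \<subseteq> sets past_algebra"
    using assms by (auto simp: past_algebra_def)
  moreover have "countable ?X"
    by (rule countable_subset[OF _ countable_cylinders_until_0]) (use assms in auto)
  ultimately show "(\<lambda>\<sigma> :: 'e code. \<sigma> k) -` A \<inter> space past_algebra \<in> sets past_algebra"
    by (simp add: sets.countable_Union)
qed simp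

lemma past_subalgebra:
  assumes "sets M = sets (code_borel :: 'e::countable code measure)"
  shows "subalgebra M (past_algebra :: 'e code measure)"
proof -
  have "id \<in> measurable code_borel (past_algebra :: 'e code measure)"
    by (intro measurable_past_algebraI) simp
  then have "sets (past_algebra :: 'e code measure) \<subseteq> sets code_borel"
    by (auto simp: measurable_def)
  then show ?thesis
    using assms sets_eq_imp_space_eq[OF assms] by (simp add: subalgebra_def)
qed

section \<open>Invariant sets and the past\<close>

text \<open>All integer powers of the shift: preimages under positive powers let past sets see later
  coordinates, and preimages under negative powers keep them in the past.\<close>

definition shift_by :: "int \<Rightarrow> 'e code \<Rightarrow> 'e code" where
  "shift_by j \<sigma> = (\<lambda>k. \<sigma> (k + j))"

lemma measurable_shift_by [measurable]:
  "shift_by j \<in> measurable code_borel (code_borel :: 'e::countable code measure)"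
  unfolding shift_by_def by (rule measurable_code_borelI) (rule coord_code_borel)

lemma measurable_shift_by_past:
  "shift_by j \<in> measurable code_borel (past_algebra :: 'e::countable code measure)"
  unfolding shift_by_def by (rule measurable_past_algebraI) (rule coord_code_borel)

lemma measurable_past_shift_by:
  assumes "j \<le> 0"
  shows "shift_by j \<in> measurable past_algebra (past_algebra :: 'e::countable code measure)"
  unfolding shift_by_def
  by (rule measurable_past_algebraI, rule coord_past_algebra) (use assms in simp)

text \<open>The union over \<open>n\<close> of the \<sigma>-algebras of the coordinates up to
  \<open>n\<close>. As an increasing union it is an algebra, and it generates the Borel
  sets.\<close>

definition eventual_past :: "'e code set set" where
  "eventual_past = {shift_by (int n) -` A | n A. A \<in> sets past_algebra}"

text \<open>A set of level \<open>m\<close> also has every level \<open>n\<close> above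
  \<open>m\<close>: pulling its past set back by the negative power \<open>m - n\<close> compensates
  the larger shift. Two sets therefore meet at the larger of their levels.\<close>

lemma eventual_pastE:
  fixes A B :: "'e::countable code set"
  assumes "A \<in> eventual_past" "B \<in> eventual_past"
  obtains n A' B' where "A' \<in> sets past_algebra" "B' \<in> sets past_algebra"
    "A = shift_by (int n) -` A'" "B = shift_by (int n) -` B'"
proof -
  have later: "\<exists>A''\<in>sets past_algebra. shift_by (int m) -` A' = shift_by (int n) -` A''"
    if "A' \<in> sets past_algebra" "m \<le> n" for m n and A' :: "'e code set"
  proof
    show "shift_by (int m - int n) -` A' \<in> sets past_algebra"
      using measurable_sets[OF measurable_past_shift_by that(1), of "int m - int n"] that(2) by simp
    show "shift_by (int m) -` A' = shift_by (int n) -` shift_by (int m - int n) -` A'"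
      by (simp add: shift_by_def vimage_def algebra_simps)
  qed
  obtain m A' where A': "A' \<in> sets past_algebra" "A = shift_by (int m) -` A'"
    using assms(1) by (auto simp: eventual_past_def)
  obtain n B' where B': "B' \<in> sets past_algebra" "B = shift_by (int n) -` B'"
    using assms(2) by (auto simp: eventual_past_def)
  show ?thesis
    using later[OF A'(1), of m "max m n"] later[OF B'(1), of n "max m n"] A'(2) B'(2) that by auto
qed

lemma algebra_eventual_past: "algebra UNIV (eventual_past :: 'e::countable code set set)"
  unfolding algebra_iff_Int
proof (intro conjI ballI)
  show "{} \<in> eventual_past"
    by (force simp: eventual_past_def)
  show "UNIV - A \<in> eventual_past" if "A \<in> eventual_past" for A :: "'e code set"
  proof -
    from that obtain n A' where "A' \<in> sets past_algebra" "A = shift_by (int n) -` A'"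
      by (auto simp: eventual_past_def)
    moreover from this(1) have "UNIV - A' \<in> sets past_algebra"
      using sets.compl_sets by fastforce
    moreover have "UNIV - shift_by (int n) -` A' = shift_by (int n) -` (UNIV - A')"
      by auto
    ultimately show ?thesis
      unfolding eventual_past_def by blast
  qed
  show "A \<inter> B \<in> eventual_past" if AB: "A \<in> eventual_past" "B \<in> eventual_past" for A B :: "'e code set"
  proof -
    obtain n A' B' where *: "A' \<in> sets past_algebra" "B' \<in> sets past_algebra"
      "A = shift_by (int n) -` A'" "B = shift_by (int n) -` B'"
      using eventual_pastE[OF AB] by metis
    then have "A \<inter> B = shift_by (int n) -` (A' \<inter> B')" "A' \<inter> B' \<in> sets past_algebra"
      by auto
    then show ?thesis
      unfolding eventual_past_def by blast
  qed
qed simp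

lemma sets_code_borel_eventual_past:
  "sets code_borel = sigma_sets UNIV (eventual_past :: 'e::countable code set set)"
proof (intro equalityI subsetI)
  fix B :: "'e code set" assume B: "B \<in> sets code_borel"
  let ?N = "sigma UNIV (eventual_past :: 'e code set set)"
  have "(\<lambda>\<sigma>. \<sigma> k) \<in> measurable ?N (count_space UNIV)" for k
  proof (rule measurableI)
    fix V :: "'e option set"
    \<comment> \<open>Since \<open>nat k\<close> is 0 for negative \<open>k\<close>, the index
      \<open>k - int (nat k)\<close> is the minimum of \<open>k\<close> and 0, hence a past
      coordinate.\<close>
    have "(\<lambda>\<sigma>. \<sigma> (k - int (nat k))) -` V \<inter> space past_algebra \<in> sets past_algebra"
      by (rule measurable_sets[OF coord_past_algebra]) auto
    moreover have "(\<lambda>\<sigma>. \<sigma> k) -` V = shift_by (int (nat k)) -` (\<lambda>\<sigma>. \<sigma> (k - int (nat k))) -` V"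
      by (simp add: shift_by_def vimage_def)
    ultimately have "(\<lambda>\<sigma>. \<sigma> k) -` V \<in> eventual_past"
      unfolding eventual_past_def Int_UNIV_right space_past_algebra by blast
    then show "(\<lambda>\<sigma>. \<sigma> k) -` V \<inter> space ?N \<in> sets ?N"
      by simp
  qed simp
  then have "id \<in> measurable ?N code_borel"
    unfolding id_def by (rule measurable_code_borelI)
  from measurable_sets[OF this B] show "B \<in> sigma_sets UNIV eventual_past"
    by (simp add: space_measure_of_conv)
next
  fix B :: "'e code set" assume "B \<in> sigma_sets UNIV eventual_past"
  moreover have "eventual_past \<subseteq> sets (code_borel :: 'e code measure)"
    using measurable_sets[OF measurable_shift_by_past] by (auto simp: eventual_past_def)
  ultimately show "B \<in> sets code_borel"
    using sets.sigma_sets_subset[of eventual_past code_borel] by auto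
qed

section \<open>Approximation of measurable sets by a generating algebra\<close>

text \<open>Induction over the Dynkin system generated by \<open>G\<close>. The claim is carried for
  all tolerances at once, because a union needs its members approximated more finely than
  itself.\<close>

lemma (in finite_measure) approx_by_algebra:
  assumes G: "algebra (space M) G" and M: "sets M = sigma_sets (space M) G"
    and "B \<in> sets M" "0 < \<epsilon>"
  shows "\<exists>A\<in>G. measure M (sym_diff B A) < \<epsilon>"
proof -
  interpret G: algebra "space M" G by fact
  have GM: "G \<subseteq> sets M" by (auto simp: M)
  have "Int_stable G" by (auto simp: Int_stable_def)
  have "B \<in> sigma_sets (space M) G" using assms(3) M by simp
  then have "\<forall>\<epsilon>>0. \<exists>A\<in>G. measure M (sym_diff B A) < \<epsilon>"
  proof (induction rule: sigma_sets_induct_disjoint[OF \<open>Int_stable G\<close> G.space_closed, consumes 1, case_names basic empty compl union])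
    case (basic A)
    then show ?case by (auto intro!: bexI[of _ A])
  next
    case empty
    then show ?case by (auto intro!: bexI[of _ "{}"])
  next
    case (compl A)
    show ?case
    proof (intro allI impI)
      fix \<epsilon> :: real assume "0 < \<epsilon>"
      with compl obtain C where C: "C \<in> G" "measure M (sym_diff A C) < \<epsilon>" by blast
      have "sym_diff (space M - A) (space M - C) = sym_diff A C"
        using C(1) GM compl(1) M sets.sets_into_space by blast
      then show "\<exists>C\<in>G. measure M (sym_diff (space M - A) C) < \<epsilon>"
        using C by (intro bexI[of _ "space M - C"]) auto
    qed
  next
    case (union A)
    have A: "range A \<subseteq> sets M" using union(2) M by simp
    show ?case
    proof (intro allI impI)
      fix \<epsilon> :: real assume \<epsilon>: "0 < \<epsilon>"
      let ?U = "\<Union>i. A i" and ?V = "\<lambda>n. \<Union>i<n. A i"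
      have "(\<lambda>n. measure M (?V n)) \<longlonglongrightarrow> measure M (\<Union>n. ?V n)"
        using A by (intro finite_Lim_measure_incseq) (fastforce simp: incseq_def)+
      moreover have "(\<Union>n. ?V n) = ?U" by auto
      ultimately have "\<forall>\<^sub>F n in sequentially. measure M ?U - \<epsilon> / 2 < measure M (?V n)"
        using \<epsilon> by (intro order_tendstoD(1)) auto
      then obtain n where n: "measure M ?U - \<epsilon> / 2 < measure M (?V n)"
        by (auto simp: eventually_sequentially)
      \<comment> \<open>The tail beyond \<open>n\<close> costs strictly less than half of
        \<open>\<epsilon>\<close>; the \<open>n\<close> approximations together cost at most the
        other half. The summand 1 keeps the quotient meaningful for \<open>n = 0\<close>.\<close>
      have "\<forall>i. \<exists>C. C \<in> G \<and> measure M (sym_diff (A i) C) < \<epsilon> / (2 * (real n + 1))"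
    proof
      fix i
      have "0 < \<epsilon> / (2 * (real n + 1))" using \<epsilon> by simp
      then show "\<exists>C. C \<in> G \<and> measure M (sym_diff (A i) C) < \<epsilon> / (2 * (real n + 1))"
        using union(3)[of i] by blast
    qed
      then obtain C where C: "\<And>i. C i \<in> G" "\<And>i. measure M (sym_diff (A i) (C i)) < \<epsilon> / (2 * (real n + 1))"
        by metis
      have CM: "C i \<in> sets M" for i using C(1) GM by blast
      have [measurable]: "A i \<in> sets M" "C i \<in> sets M" for i using A CM by auto
      have "measure M (sym_diff ?U (\<Union>i<n. C i))
          \<le> measure M ((?U - ?V n) \<union> (\<Union>i<n. sym_diff (A i) (C i)))"
        by (rule finite_measure_mono) auto
      also have "\<dots> \<le> measure M (?U - ?V n) + measure M (\<Union>i<n. sym_diff (A i) (C i))"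
        by (rule measure_Un_le) auto
      also have "measure M (?U - ?V n) = measure M ?U - measure M (?V n)"
        by (rule finite_measure_Diff) auto
      also have "measure M (\<Union>i<n. sym_diff (A i) (C i)) \<le> (\<Sum>i<n. measure M (sym_diff (A i) (C i)))"
        by (rule finite_measure_subadditive_finite) auto
      also have "\<dots> \<le> (\<Sum>i<n. \<epsilon> / (2 * (real n + 1)))"
        by (intro sum_mono less_imp_le C)
      also have "\<dots> \<le> \<epsilon> / 2"
        using \<epsilon> by (simp add: field_simps)
      finally have "measure M (sym_diff ?U (\<Union>i<n. C i)) < \<epsilon>"
        using n by linarith
      then show "\<exists>C\<in>G. measure M (sym_diff ?U C) < \<epsilon>"
        using C(1) by (intro bexI[of _ "\<Union>i<n. C i"]) auto
    qed
  qed
  then show ?thesis using assms(4) by blast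
qed

section \<open>Shift invariance up to null sets\<close>

lemma
  assumes "M \<in> shift_invariant"
  shows shift_invariant_prob_space: "prob_space M"
    and shift_invariant_sets: "sets M = sets code_borel"
    and shift_invariant_space: "space M = UNIV"
    and shift_invariant_distr: "distr M M shift = M"
proof -
  show "prob_space M" "sets M = sets code_borel" "distr M M shift = M"
    using assms unfolding shift_invariant_def by blast+
  then show "space M = UNIV"
    using sets_eq_imp_space_eq[of M code_borel] by simp
qed

lemma shift_by_1: "shift_by 1 = shift"
  by (simp add: shift_by_def shift_def fun_eq_iff)

lemma shift_by_Suc: "shift_by (int (Suc n)) \<sigma> = shift_by (int n) (shift \<sigma>)"
  by (simp add: shift_by_def shift_def fun_eq_iff algebra_simps)

lemma measure_shift_by:
  fixes M :: "'e::countable code measure"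
  assumes M: "M \<in> shift_invariant" and A: "A \<in> sets code_borel"
  shows "measure M (shift_by (int n) -` A) = measure M A"
proof (induction n)
  case 0
  show ?case by (simp add: shift_by_def)
next
  case (Suc n)
  note sets = shift_invariant_sets[OF M] and sp = shift_invariant_space[OF M]
  have "shift_by (int n) -` A \<in> sets M"
    using measurable_sets[OF measurable_shift_by A, of "int n"] sets by simp
  moreover have "shift \<in> measurable M M"
    using measurable_shift_by[of 1] by (simp add: measurable_cong_sets[OF sets sets] shift_by_1)
  ultimately have "measure (distr M M shift) (shift_by (int n) -` A) = measure M (shift -` shift_by (int n) -` A)"
    by (simp add: measure_distr sp)
  then show ?case
    using Suc by (simp add: shift_invariant_distr[OF M] vimage_def shift_by_Suc del: of_nat_Suc)
qed

lemma measurable_shift [measurable]: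
  "shift \<in> measurable code_borel (code_borel :: 'e::countable code measure)"
  using measurable_shift_by[of 1] by (simp add: shift_by_1)

lemma AE_shift:
  fixes M :: "'e::countable code measure"
  assumes M: "M \<in> shift_invariant" and AE: "AE \<sigma> in M. P \<sigma>"
  shows "AE \<sigma> in M. P (shift \<sigma>)"
proof -
  have "shift \<in> measurable M M"
    using measurable_shift by (simp add: measurable_cong_sets[OF shift_invariant_sets[OF M] shift_invariant_sets[OF M]])
  moreover have "AE \<sigma> in distr M M shift. P \<sigma>"
    using AE by (simp only: shift_invariant_distr[OF M])
  ultimately show ?thesis
    by (rule AE_distrD)
qed

text \<open>The generators of \<open>invariant_algebra\<close> already form a \<sigma>-algebra, so
  generating adds nothing. Invariance is phrased as an equivalence almost everywhere because this
  form passes to complements and countable unions at once.\<close>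

lemma invariant_algebra_sets:
  fixes M :: "'e::countable code measure"
  assumes M: "M \<in> shift_invariant" and B: "B \<in> sets (invariant_algebra M)"
  shows "B \<in> sets code_borel" and "AE \<sigma> in M. shift \<sigma> \<in> B \<longleftrightarrow> \<sigma> \<in> B"
proof -
  have "B \<in> sigma_sets UNIV {B \<in> sets code_borel. emeasure M (sym_diff (shift -` B) B) = 0}"
    using B by (simp add: invariant_algebra_def)
  then have "B \<in> sets code_borel \<and> (AE \<sigma> in M. shift \<sigma> \<in> B \<longleftrightarrow> \<sigma> \<in> B)"
  proof induction
    case (Basic B)
    then have B: "B \<in> sets code_borel" "emeasure M (sym_diff (shift -` B) B) = 0"
      by auto
    have "shift -` B \<in> sets M"
      using measurable_sets[OF measurable_shift B(1)] by (simp add: shift_invariant_sets[OF M])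
    moreover have "B \<in> sets M"
      using B(1) by (simp add: shift_invariant_sets[OF M])
    ultimately have "sym_diff (shift -` B) B \<in> null_sets M"
      using B(2) by (intro null_setsI sets.Un sets.Diff)
    then have "AE \<sigma> in M. \<sigma> \<notin> sym_diff (shift -` B) B"
      by (rule AE_not_in)
    then have "AE \<sigma> in M. shift \<sigma> \<in> B \<longleftrightarrow> \<sigma> \<in> B"
      by eventually_elim auto
    then show ?case using B(1) by blast
  next
    case Empty
    then show ?case by simp
  next
    case (Compl B)
    have "UNIV - B \<in> sets code_borel"
      using Compl.IH sets.compl_sets[of B code_borel] by simp
    then show ?case using Compl.IH by simp
  next
    case (Union A)
    then have "AE \<sigma> in M. \<forall>i. shift \<sigma> \<in> A i \<longleftrightarrow> \<sigma> \<in> A i"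
      by (simp add: AE_all_countable)
    then have "AE \<sigma> in M. shift \<sigma> \<in> \<Union> (range A) \<longleftrightarrow> \<sigma> \<in> \<Union> (range A)"
      by eventually_elim auto
    moreover have "\<Union> (range A) \<in> sets code_borel"
      using Union.IH by (intro sets.countable_UN) auto
    ultimately show ?case by blast
  qed
  then show "B \<in> sets code_borel" and "AE \<sigma> in M. shift \<sigma> \<in> B \<longleftrightarrow> \<sigma> \<in> B"
    by auto
qed

lemma invariant_subalgebra:
  fixes M :: "'e::countable code measure"
  assumes M: "M \<in> shift_invariant"
  shows "subalgebra M (invariant_algebra M)"
proof -
  have "space (invariant_algebra M) = UNIV"
    by (simp add: invariant_algebra_def space_measure_of_conv)
  then show ?thesis
    using invariant_algebra_sets(1)[OF M]
    by (auto simp: subalgebra_def shift_invariant_space[OF M] shift_invariant_sets[OF M])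
qed

text \<open>Approximate an invariant set by a set depending on the coordinates up to \<open>n\<close>,
  then shift the approximating set into the past.\<close>

lemma invariant_set_approx_past:
  fixes M :: "'e::countable code measure"
  assumes M: "M \<in> shift_invariant" and B: "B \<in> sets (invariant_algebra M)" and "0 < \<epsilon>"
  obtains C where "C \<in> sets past_algebra" "measure M (sym_diff B C) < \<epsilon>"
proof -
  interpret prob_space M by (rule shift_invariant_prob_space[OF M])
  note [simp] = shift_invariant_sets[OF M] shift_invariant_space[OF M]
  note inv = invariant_algebra_sets[OF M B]
  have "\<exists>A\<in>eventual_past. measure M (sym_diff B A) < \<epsilon>"
    using inv(1) \<open>0 < \<epsilon>\<close>
    by (intro approx_by_algebra) (simp_all add: algebra_eventual_past sets_code_borel_eventual_past)
  then obtain n A where A: "A \<in> sets past_algebra" "measure M (sym_diff B (shift_by (int n) -` A)) < \<epsilon>"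
    by (auto simp: eventual_past_def)
  have A': "A \<in> sets code_borel"
    using past_subalgebra[of code_borel] A(1) by (auto simp: subalgebra_def)
  have AE: "AE \<sigma> in M. shift_by (int n) \<sigma> \<in> B \<longleftrightarrow> \<sigma> \<in> B"
  proof (induction n)
    case 0
    show ?case by (simp add: shift_by_def)
  next
    case (Suc n)
    then have "AE \<sigma> in M. shift_by (int n) (shift \<sigma>) \<in> B \<longleftrightarrow> shift \<sigma> \<in> B"
      by (rule AE_shift[OF M])
    then show ?case
      using inv(2) unfolding shift_by_Suc by eventually_elim simp
  qed
  have pre: "shift_by (int n) -` X \<in> sets code_borel" if "X \<in> sets code_borel" for X :: "'e code set"
    using measurable_sets[OF measurable_shift_by that] by simp
  \<comment> \<open>Pulling back by \<open>n\<close> steps preserves the measure of the difference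
    and changes \<open>B\<close> only by a null set. So \<open>A\<close> is exactly as close to
    \<open>B\<close> as its preimage is.\<close>
  have "measure M (sym_diff B A) = measure M (shift_by (int n) -` sym_diff B A)"
    by (rule measure_shift_by[OF M, symmetric]) (intro sets.Un sets.Diff inv(1) A')
  also have "\<dots> = measure M (sym_diff B (shift_by (int n) -` A))"
  proof (rule finite_measure_eq_AE)
    show "AE \<sigma> in M. \<sigma> \<in> shift_by (int n) -` sym_diff B A \<longleftrightarrow> \<sigma> \<in> sym_diff B (shift_by (int n) -` A)"
      using AE by eventually_elim auto
  qed (use inv(1) A' pre in \<open>simp_all add: sets.Un sets.Diff\<close>)
  finally show ?thesis
    using A that by simp
qed

section \<open>Integrals over invariant sets and over components\<close>

text \<open>As \<open>h\<close> is bounded by 1, passing from \<open>B\<close> to a past set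
  \<open>C\<close> changes the integral by at most the measure of their symmetric difference, which
  can be made arbitrarily small.\<close>

lemma invariant_set_integral_eq_0:
  fixes M :: "'e::countable code measure" and h :: "'e code \<Rightarrow> real"
  assumes M: "M \<in> shift_invariant" and h: "h \<in> borel_measurable code_borel" "\<And>\<sigma>. \<bar>h \<sigma>\<bar> \<le> 1"
    and past: "\<And>C. C \<in> sets past_algebra \<Longrightarrow> (\<integral>\<sigma>\<in>C. h \<sigma> \<partial>M) = 0"
    and B: "B \<in> sets (invariant_algebra M)"
  shows "(\<integral>\<sigma>\<in>B. h \<sigma> \<partial>M) = 0"
proof -
  interpret prob_space M by (rule shift_invariant_prob_space[OF M])
  note [measurable_cong] = shift_invariant_sets[OF M]
  note [measurable] = h(1) invariant_algebra_sets(1)[OF M B]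
  have "\<bar>\<integral>\<sigma>\<in>B. h \<sigma> \<partial>M\<bar> \<le> \<epsilon>" if \<epsilon>: "0 < \<epsilon>" for \<epsilon>
  proof -
    obtain C where C: "C \<in> sets past_algebra" "measure M (sym_diff B C) < \<epsilon>"
      using invariant_set_approx_past[OF M B \<epsilon>] by metis
    have [measurable]: "C \<in> sets code_borel"
      using past_subalgebra[of code_borel] C(1) by (auto simp: subalgebra_def)
    have int: "integrable M (\<lambda>\<sigma>. indicator X \<sigma> *\<^sub>R h \<sigma>)" if [measurable]: "X \<in> sets code_borel" for X
      using h(2) by (intro integrable_const_bound[of _ 1]) (auto simp: indicator_def)
    have "(\<integral>\<sigma>\<in>B. h \<sigma> \<partial>M) = (\<integral>\<sigma>\<in>B. h \<sigma> \<partial>M) - (\<integral>\<sigma>\<in>C. h \<sigma> \<partial>M)"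
      using past[OF C(1)] by simp
    also have "\<dots> = (\<integral>\<sigma>. indicator B \<sigma> *\<^sub>R h \<sigma> - indicator C \<sigma> *\<^sub>R h \<sigma> \<partial>M)"
      unfolding set_lebesgue_integral_def by (intro Bochner_Integration.integral_diff[symmetric] int) auto
    also have "\<bar>\<dots>\<bar> \<le> (\<integral>\<sigma>. indicator (sym_diff B C) \<sigma> \<partial>M)"
    proof (rule order_trans[OF integral_abs_bound], rule integral_mono)
      show "integrable M (\<lambda>\<sigma>. \<bar>indicator B \<sigma> *\<^sub>R h \<sigma> - indicator C \<sigma> *\<^sub>R h \<sigma>\<bar>)"
        by (intro integrable_abs Bochner_Integration.integrable_diff int) auto
      show "integrable M (\<lambda>\<sigma>. indicator (sym_diff B C) \<sigma> :: real)"
        by (intro integrable_const_bound[of _ 1]) auto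
      show "\<bar>indicator B \<sigma> *\<^sub>R h \<sigma> - indicator C \<sigma> *\<^sub>R h \<sigma>\<bar> \<le> indicator (sym_diff B C) \<sigma>" for \<sigma>
        using h(2)[of \<sigma>] by (auto simp: indicator_def)
    qed
    also have "\<dots> = measure M (sym_diff B C)"
      by (simp add: shift_invariant_space[OF M])
    finally show ?thesis using C(2) by simp
  qed
  then show ?thesis
    by (metis abs_le_zero_iff dense_ge)
qed

text \<open>The hypothesis says that the zero function has the defining property of the conditional
  expectation of \<open>f\<close> given the invariant sets.\<close>

lemma decomposition_integral_eq_0:
  fixes M :: "'e::countable code measure" and f :: "'e code \<Rightarrow> real"
  assumes M: "M \<in> shift_invariant" and L: "ergodic_decomposition M L" and f: "integrable M f"
    and zero: "\<And>B. B \<in> sets (invariant_algebra M) \<Longrightarrow> (\<integral>\<sigma>\<in>B. f \<sigma> \<partial>M) = 0"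
  shows "AE \<omega> in M. (\<integral>\<sigma>. f \<sigma> \<partial>L \<omega>) = 0"
proof -
  interpret prob_space M by (rule shift_invariant_prob_space[OF M])
  interpret finite_measure_subalgebra M "invariant_algebra M"
    by unfold_locales (rule invariant_subalgebra[OF M])
  have "AE \<omega> in M. real_cond_exp M (invariant_algebra M) f \<omega> = 0"
    by (rule real_cond_exp_charact) (use f zero in simp_all)
  moreover have "AE \<omega> in M. (\<integral>\<sigma>. f \<sigma> \<partial>L \<omega>) = real_cond_exp M (invariant_algebra M) f \<omega>"
    using L f unfolding ergodic_decomposition_def by blast
  ultimately show ?thesis
    by eventually_elim simp
qed

lemma decomposition_shift_invariant:
  assumes "ergodic_decomposition M L"
  shows "L \<omega> \<in> shift_invariant"
  using assms unfolding ergodic_decomposition_def ergodic_def by blast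

lemma decomposition_full_measure:
  fixes M :: "'e::countable code measure"
  assumes M: "M \<in> shift_invariant" and L: "ergodic_decomposition M L"
    and D: "D \<in> sets code_borel" "measure M D = 1"
  shows "AE \<omega> in M. measure (L \<omega>) D = 1"
proof -
  interpret prob_space M by (rule shift_invariant_prob_space[OF M])
  note [measurable_cong] = shift_invariant_sets[OF M]
  note [measurable] = D(1)
  have AE: "AE \<sigma> in M. \<sigma> \<in> D"
    using D(2) by (simp add: prob_eq_1)
  have "AE \<omega> in M. (\<integral>\<sigma>. indicator (- D) \<sigma> \<partial>L \<omega>) = (0 :: real)"
  proof (rule decomposition_integral_eq_0[OF M L])
    show "integrable M (indicator (- D) :: _ \<Rightarrow> real)"
      by (intro integrable_const_bound[of _ 1]) auto
    fix B
    have "AE \<sigma> in M. indicator B \<sigma> *\<^sub>R (indicator (- D) \<sigma> :: real) = 0"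
      using AE by eventually_elim simp
    then show "(\<integral>\<sigma>\<in>B. (indicator (- D) \<sigma> :: real) \<partial>M) = 0"
      unfolding set_lebesgue_integral_def by (rule integral_eq_zero_AE)
  qed
  then show ?thesis
  proof eventually_elim
    case (elim \<omega>)
    note L\<omega> = decomposition_shift_invariant[OF L, of \<omega>]
    interpret L: prob_space "L \<omega>" by (rule shift_invariant_prob_space[OF L\<omega>])
    have "measure (L \<omega>) (space (L \<omega>) - D) = 0"
      using elim by (simp add: shift_invariant_space[OF L\<omega>] Compl_eq_Diff_UNIV)
    then show ?case
      using L.prob_compl[of D] D(1) by (simp add: shift_invariant_sets[OF L\<omega>])
  qed
qed

section \<open>Conditioning the ergodic components on the past\<close>

text \<open>The empty set is added to close the family under intersections, and the whole space to
  start the complement step of the Dynkin induction.\<close>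

definition past_cylinders :: "'e code set set" where
  "past_cylinders = insert {} (insert UNIV {cylinder m 0 c | m c. m \<le> 0})"

text \<open>Cylinders with a common point \<open>\<tau>\<close> are both cylinders around
  \<open>\<tau>\<close>, so their intersection is the longer of the two.\<close>

lemma Int_stable_past_cylinders: "Int_stable past_cylinders"
proof (rule Int_stableI)
  have *: "cylinder m 0 c \<inter> cylinder m' 0 c' \<in> past_cylinders" if "m \<le> 0" for m m' and c c' :: "'a code"
  proof (cases "cylinder m 0 c \<inter> cylinder m' 0 c' = {}")
    case False
    then obtain \<tau> where \<tau>: "\<tau> \<in> cylinder m 0 c" "\<tau> \<in> cylinder m' 0 c'"
      by blast
    have "cylinder m 0 c = cylinder m 0 \<tau>" "cylinder m' 0 c' = cylinder m' 0 \<tau>"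
      using \<tau> by (auto simp: cylinder_def)
    then have "cylinder m 0 c \<inter> cylinder m' 0 c' = cylinder (min m m') 0 \<tau>"
      unfolding cylinder_def by (auto simp: min_le_iff_disj)
    moreover have "min m m' \<le> 0" using that by simp
    ultimately show ?thesis
      unfolding past_cylinders_def by blast
  qed (simp add: past_cylinders_def)
  then show "A \<inter> B \<in> past_cylinders" if "A \<in> past_cylinders" "B \<in> past_cylinders" for A B :: "'a code set"
  proof -
    have "A = {} \<or> A = UNIV \<or> (\<exists>m c. A = cylinder m 0 c \<and> m \<le> 0)"
      "B = {} \<or> B = UNIV \<or> (\<exists>m c. B = cylinder m 0 c \<and> m \<le> 0)"
      using that by (simp_all add: past_cylinders_def)
    moreover have empty: "{} \<in> past_cylinders"
      by (simp add: past_cylinders_def)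
    ultimately show ?thesis
      using that * by (elim disjE exE conjE) (simp_all add: empty)
  qed
qed

lemma countable_past_cylinders: "countable (past_cylinders :: 'e::countable code set set)"
  unfolding past_cylinders_def by (intro countable_insert countable_cylinders_until_0)

lemma past_cylinders_subset: "past_cylinders \<subseteq> sets past_algebra"
proof -
  have "{cylinder m 0 c | m c. m \<le> 0} \<subseteq> sets past_algebra"
    by (auto simp: past_algebra_def)
  moreover have "UNIV \<in> sets past_algebra"
    using sets.top[of past_algebra] by simp
  ultimately show ?thesis
    by (simp add: past_cylinders_def)
qed

lemma sets_past_algebra: "sets past_algebra = sigma_sets UNIV past_cylinders"
proof
  show "sets past_algebra \<subseteq> sigma_sets UNIV past_cylinders"
    by (auto simp: past_algebra_def past_cylinders_def intro!: sigma_sets_mono')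
  show "sigma_sets UNIV past_cylinders \<subseteq> sets past_algebra"
    using sets.sigma_sets_subset[OF past_cylinders_subset] by simp
qed

lemma past_sets_code_borel:
  "A \<in> sets past_algebra \<Longrightarrow> A \<in> sets (code_borel :: 'e::countable code measure)"
  using past_subalgebra[of code_borel] by (auto simp: subalgebra_def)

text \<open>Since \<open>h\<close> may change sign, uniqueness of measures does not apply directly;
  instead the sets with vanishing integral are shown to form a Dynkin system.\<close>

lemma past_integral_eq_0:
  fixes M :: "'e::countable code measure" and h :: "'e code \<Rightarrow> real"
  assumes M: "M \<in> shift_invariant" and h: "integrable M h"
    and cyl: "\<And>C. C \<in> past_cylinders \<Longrightarrow> (\<integral>\<sigma>\<in>C. h \<sigma> \<partial>M) = 0"
    and A: "A \<in> sets past_algebra"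
  shows "(\<integral>\<sigma>\<in>A. h \<sigma> \<partial>M) = 0"
proof -
  have int: "integrable M (\<lambda>\<sigma>. indicator X \<sigma> *\<^sub>R h \<sigma>)" if "X \<in> sets past_algebra" for X
    using past_sets_code_borel[OF that] h
    by (intro integrable_mult_indicator) (simp_all add: shift_invariant_sets[OF M])
  have *: "past_cylinders \<subseteq> Pow (UNIV :: 'e code set)"
    by simp
  show ?thesis
    using A[unfolded sets_past_algebra]
  proof (induction rule: sigma_sets_induct_disjoint[OF Int_stable_past_cylinders *, consumes 1, case_names basic empty compl union])
    case (basic A)
    then show ?case by (rule cyl)
  next
    case empty
    show ?case by (simp add: set_lebesgue_integral_def)
  next
    case (compl A)
    then have A: "A \<in> sets past_algebra" by (simp add: sets_past_algebra)
    have "(\<integral>\<sigma>\<in>UNIV - A. h \<sigma> \<partial>M) = (\<integral>\<sigma>. indicator UNIV \<sigma> *\<^sub>R h \<sigma> - indicator A \<sigma> *\<^sub>R h \<sigma> \<partial>M)"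
      unfolding set_lebesgue_integral_def by (intro Bochner_Integration.integral_cong) (auto simp: indicator_def)
    also have "\<dots> = (\<integral>\<sigma>\<in>UNIV. h \<sigma> \<partial>M) - (\<integral>\<sigma>\<in>A. h \<sigma> \<partial>M)"
      unfolding set_lebesgue_integral_def using past_cylinders_subset
      by (intro Bochner_Integration.integral_diff int A) (auto simp: past_cylinders_def)
    also have "\<dots> = 0"
      using compl(2) cyl[of UNIV] by (simp add: past_cylinders_def)
    finally show ?case .
  next
    case (union A)
    then have A: "A i \<in> sets past_algebra" for i by (auto simp: sets_past_algebra)
    then have "(\<Union>i. A i) \<in> sets past_algebra" by blast
    then have "(\<integral>\<sigma>\<in>(\<Union>i. A i). h \<sigma> \<partial>M) = (\<Sum>i. (\<integral>\<sigma>\<in>A i. h \<sigma> \<partial>M))"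
      using union(1) past_sets_code_borel[OF A]
      by (intro lebesgue_integral_countable_add)
        (auto simp: disjoint_family_on_def set_integrable_def int shift_invariant_sets[OF M] simp del: real_scaleR_def)
    then show ?case using union(3) by simp
  qed
qed

text \<open>One fixed past-measurable \<open>u\<close> serves as candidate for \<open>M\<close> and
  for all components. For each measure, being a version of the conditional expectation means that
  \<open>indicator E - u\<close> integrates to 0 over past sets, and countably many cylinders
  suffice to test this outside a single null set of \<omega>.\<close>

lemma decomposition_cond_exp:
  fixes M :: "'e::countable code measure"
  assumes M: "M \<in> shift_invariant" and L: "ergodic_decomposition M L"
    and E: "E \<in> sets code_borel"
    and u: "u \<in> borel_measurable past_algebra" "\<And>\<sigma>. u \<sigma> \<in> {0..1 :: real}"
    and ce: "AE \<sigma> in M. real_cond_exp M past_algebra (indicator E) \<sigma> = u \<sigma>"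
  shows "AE \<omega> in M. AE \<sigma> in L \<omega>. real_cond_exp (L \<omega>) past_algebra (indicator E) \<sigma> = u \<sigma>"
proof -
  interpret prob_space M by (rule shift_invariant_prob_space[OF M])
  interpret finite_measure_subalgebra M past_algebra
    by unfold_locales (rule past_subalgebra[OF shift_invariant_sets[OF M]])
  note [measurable_cong] = shift_invariant_sets[OF M]
  have u'[measurable]: "u \<in> borel_measurable code_borel"
    by (rule measurable_from_subalg[OF past_subalgebra[OF refl] u(1)])
  note [measurable] = E
  define h where "h \<sigma> = indicator E \<sigma> - u \<sigma>" for \<sigma>
  have h[measurable]: "h \<in> borel_measurable code_borel"
    unfolding h_def by measurable
  have h_le: "\<bar>h \<sigma>\<bar> \<le> 1" for \<sigma>
    using u(2)[of \<sigma>] by (auto simp: h_def indicator_def)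
  have int: "integrable N f" if "N \<in> shift_invariant" "f \<in> borel_measurable code_borel" "\<And>\<sigma>. \<bar>f \<sigma>\<bar> \<le> 1"
    for N :: "'e code measure" and f :: "'e code \<Rightarrow> real"
  proof -
    interpret N: prob_space N by (rule shift_invariant_prob_space[OF that(1)])
    show ?thesis
      using that by (intro N.integrable_const_bound[of _ 1])
        (auto simp: measurable_cong_sets[OF shift_invariant_sets[OF that(1)] refl])
  qed
  have u_le: "\<bar>u \<sigma>\<bar> \<le> 1" for \<sigma> using u(2)[of \<sigma>] by auto
  have E_le: "\<bar>indicator E \<sigma> :: real\<bar> \<le> 1" for \<sigma> by (simp add: indicator_def)
  have E_meas: "(indicator E :: _ \<Rightarrow> real) \<in> borel_measurable code_borel" by measurable
  have diff: "(\<integral>\<sigma>\<in>A. h \<sigma> \<partial>N) = (\<integral>\<sigma>\<in>A. indicator E \<sigma> \<partial>N) - (\<integral>\<sigma>\<in>A. u \<sigma> \<partial>N)"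
    if "N \<in> shift_invariant" "A \<in> sets past_algebra" for N A
  proof -
    have "A \<in> sets N"
      using past_sets_code_borel[OF that(2)] by (simp add: shift_invariant_sets[OF that(1)])
    then show ?thesis
      unfolding h_def using int[OF that(1) E_meas E_le] int[OF that(1) u' u_le]
      by (intro set_integral_diff) (simp_all add: set_integrable_def integrable_mult_indicator del: real_scaleR_def)
  qed
  have past: "(\<integral>\<sigma>\<in>C. h \<sigma> \<partial>M) = 0" if C: "C \<in> sets past_algebra" for C
  proof -
    have [measurable]: "C \<in> sets code_borel" by (rule past_sets_code_borel[OF C])
    have "(\<integral>\<sigma>\<in>C. indicator E \<sigma> \<partial>M) = (\<integral>\<sigma>\<in>C. real_cond_exp M past_algebra (indicator E) \<sigma> \<partial>M)"
      by (intro real_cond_exp_intA C int[OF M E_meas E_le])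
    also have "\<dots> = (\<integral>\<sigma>\<in>C. u \<sigma> \<partial>M)"
    proof -
      have "AE \<sigma> in M. indicator C \<sigma> *\<^sub>R real_cond_exp M past_algebra (indicator E) \<sigma> = indicator C \<sigma> *\<^sub>R u \<sigma>"
        using ce by eventually_elim simp
      then show ?thesis
        unfolding set_lebesgue_integral_def by (intro integral_cong_AE) auto
    qed
    finally show ?thesis using diff[OF M C] by simp
  qed
  have "AE \<omega> in M. \<forall>C\<in>past_cylinders. (\<integral>\<sigma>\<in>C. h \<sigma> \<partial>L \<omega>) = 0"
    unfolding AE_ball_countable[OF countable_past_cylinders]
  proof
    fix A :: "'e code set" assume "A \<in> past_cylinders"
    then have A: "A \<in> sets past_algebra" using past_cylinders_subset by blast
    have [measurable]: "A \<in> sets code_borel" by (rule past_sets_code_borel[OF A])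
    have hA: "(\<lambda>\<sigma>. indicator A \<sigma> *\<^sub>R h \<sigma>) \<in> borel_measurable code_borel" by measurable
    have hA_le: "\<bar>indicator A \<sigma> *\<^sub>R h \<sigma>\<bar> \<le> 1" for \<sigma>
      using h_le[of \<sigma>] by (simp add: indicator_def)
    show "AE \<omega> in M. (\<integral>\<sigma>\<in>A. h \<sigma> \<partial>L \<omega>) = 0"
      unfolding set_lebesgue_integral_def
    \<comment> \<open>The weight \<open>indicator A\<close> preserves the hypothesis on past sets:
      integrating over \<open>C\<close> then means integrating \<open>h\<close> over
      \<open>C \<inter> A\<close>, again a past set.\<close>
    proof (rule decomposition_integral_eq_0[OF M L int[OF M hA hA_le]], rule invariant_set_integral_eq_0[OF M hA hA_le])
      fix C :: "'e code set" assume "C \<in> sets past_algebra"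
      then have "(\<integral>\<sigma>\<in>C \<inter> A. h \<sigma> \<partial>M) = 0" using A by (intro past sets.Int)
      then show "(\<integral>\<sigma>\<in>C. (indicator A \<sigma> *\<^sub>R h \<sigma>) \<partial>M) = 0"
        by (simp add: set_lebesgue_integral_def indicator_inter_arith mult.assoc)
    qed
  qed
  then show ?thesis
  proof eventually_elim
    case (elim \<omega>)
    note L\<omega> = decomposition_shift_invariant[OF L, of \<omega>]
    interpret L: prob_space "L \<omega>" by (rule shift_invariant_prob_space[OF L\<omega>])
    interpret L: finite_measure_subalgebra "L \<omega>" past_algebra
      by unfold_locales (rule past_subalgebra[OF shift_invariant_sets[OF L\<omega>]])
    show ?case
    proof (rule L.real_cond_exp_charact)
      fix A :: "'e code set" assume A: "A \<in> sets past_algebra"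
      have "(\<integral>\<sigma>\<in>A. h \<sigma> \<partial>L \<omega>) = 0"
        by (rule past_integral_eq_0[OF L\<omega> int[OF L\<omega> h h_le] _ A]) (use elim in blast)
      then show "(\<integral>\<sigma>\<in>A. indicator E \<sigma> \<partial>L \<omega>) = (\<integral>\<sigma>\<in>A. u \<sigma> \<partial>L \<omega>)"
        using diff[OF L\<omega> A] by simp
    qed (use int[OF L\<omega> E_meas E_le] int[OF L\<omega> u' u_le] u(1) in auto)
  qed
qed

text \<open>The interface for both classes: \<open>v\<close> is the prescribed right-hand side,
  which may look at all coordinates, and \<open>u\<close> is its past-measurable substitute. They
  are exchanged on \<open>D\<close>, once under \<open>M\<close> and once under each good
  component.\<close>

lemma decomposition_coding:
  fixes M :: "'e::countable code measure" and v :: "'e \<Rightarrow> 'e code \<Rightarrow> real"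
  assumes M: "M \<in> shift_invariant" and L: "ergodic_decomposition M L"
    and D: "D \<in> sets code_borel" "measure M D = 1"
    and u: "\<And>e. u e \<in> borel_measurable past_algebra" "\<And>e \<sigma>. u e \<sigma> \<in> {0..1 :: real}"
    and uv: "\<And>e \<sigma>. \<sigma> \<in> D \<Longrightarrow> u e \<sigma> = v e \<sigma>"
    and ce: "\<And>e. AE \<sigma> in M.
      real_cond_exp M past_algebra (indicator (cylinder 1 1 (\<lambda>_. Some e))) \<sigma> = v e \<sigma>"
  shows "AE \<omega> in M. L \<omega> \<in> shift_invariant \<and> measure (L \<omega>) D = 1 \<and>
    (\<forall>e. AE \<sigma> in L \<omega>.
      real_cond_exp (L \<omega>) past_algebra (indicator (cylinder 1 1 (\<lambda>_. Some e))) \<sigma> = v e \<sigma>)"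
proof -
  have full: "AE \<sigma> in N. \<sigma> \<in> D" if "N \<in> shift_invariant" "measure N D = 1" for N
  proof -
    interpret N: prob_space N by (rule shift_invariant_prob_space[OF that(1)])
    show ?thesis
      using that(2) D(1) by (simp add: N.prob_eq_1 shift_invariant_sets[OF that(1)])
  qed
  have cyl: "cylinder 1 1 c \<in> sets code_borel" for c :: "'e code"
    using measurable_sets[OF coord_code_borel[of 1], of "{c 1}"]
    by (simp add: cylinder_def vimage_def)
  have "AE \<sigma> in M. real_cond_exp M past_algebra (indicator (cylinder 1 1 (\<lambda>_. Some e))) \<sigma> = u e \<sigma>" for e
    using ce[of e] full[OF M D(2)] by eventually_elim (simp add: uv)
  then have "AE \<omega> in M. \<forall>e. AE \<sigma> in L \<omega>.
      real_cond_exp (L \<omega>) past_algebra (indicator (cylinder 1 1 (\<lambda>_. Some e))) \<sigma> = u e \<sigma>"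
    unfolding AE_all_countable by (intro allI decomposition_cond_exp[OF M L cyl u])
  with decomposition_full_measure[OF M L D] show ?thesis
  proof eventually_elim
    case (elim \<omega>)
    note L\<omega> = decomposition_shift_invariant[OF L, of \<omega>]
    have "AE \<sigma> in L \<omega>.
      real_cond_exp (L \<omega>) past_algebra (indicator (cylinder 1 1 (\<lambda>_. Some e))) \<sigma> = v e \<sigma>" for e
      using elim(2)[rule_format, of e] full[OF L\<omega> elim(1)] by eventually_elim (simp add: uv)
    then show ?case using L\<omega> elim(1) by blast
  qed
qed

section \<open>Measurability of the coding map\<close>

lemma past_comp_cong:
  "(\<And>k. k \<in> {- int j..0} \<Longrightarrow> \<sigma> k = \<tau> k) \<Longrightarrow> past_comp Q \<sigma> j = past_comp Q \<tau> j"
proof (induction j)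
  case (Suc j)
  have "past_comp Q \<sigma> j = past_comp Q \<tau> j"
    by (rule Suc.IH) (use Suc.prems in auto)
  moreover have "\<sigma> (- int (Suc j)) = \<tau> (- int (Suc j))"
    by (rule Suc.prems) auto
  ultimately show ?case by (simp only: past_comp.simps)
qed simp

lemma past_point_cong:
  assumes "\<And>k. k \<in> {- int j..0} \<Longrightarrow> \<sigma> k = \<tau> k"
  shows "past_point Q n x \<sigma> j = past_point Q n x \<tau> j"
  using past_comp_cong[of j \<sigma> \<tau> Q] assms[of "- int j"] assms by (simp add: past_point_def)

lemma measurable_past_coordinates:
  fixes f :: "'e::countable code \<Rightarrow> 'b"
  assumes f: "\<And>\<sigma> \<tau>. (\<And>k. k \<in> {m..0} \<Longrightarrow> \<sigma> k = \<tau> k) \<Longrightarrow> f \<sigma> = f \<tau>" and R: "\<And>\<sigma>. f \<sigma> \<in> space R"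
  shows "f \<in> measurable past_algebra R"
  by (rule measurable_finite_coordinates[of "{m..0}", OF _ coord_past_algebra _ f R]) auto

lemma path_space_sets: "path_space Q n \<in> sets (code_borel :: 'e::countable code measure)"
proof -
  let ?P = "\<lambda>k (\<sigma> :: 'e code). \<sigma> k \<noteq> None \<and> src_ext Q n (\<sigma> (k + 1)) = tgt_ext Q n (\<sigma> k)"
  have "?P k \<in> measurable code_borel (count_space UNIV)" for k
    by (rule measurable_finite_coordinates[of "{k, k + 1}"]) (auto intro: coord_code_borel)
  then have "{\<sigma> \<in> space code_borel. ?P k \<sigma>} \<in> sets code_borel" for k
    by (rule predE)
  then have "{\<sigma> \<in> space code_borel. \<forall>k. ?P k \<sigma>} \<in> sets code_borel"
    by (rule sets.sets_Collect_countable_All)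
  then show ?thesis by (simp add: path_space_def)
qed

text \<open>The points \<open>past_point Q n x \<sigma> j\<close> depend on finitely many coordinates in a countable
  alphabet, so no separability of \<open>'k\<close> is needed for measurability.\<close>

lemma past_convergent_sets:
  fixes Q :: "('k::complete_space, 'e::countable, 'n) msys"
  shows "{\<sigma>. convergent (past_point Q n x \<sigma>)} \<in> sets past_algebra"
proof -
  \<comment> \<open>In a complete space convergence is the Cauchy property, and with the tolerances
    \<open>inverse (real (Suc i))\<close> this is a countable combination of conditions on finitely
    many past coordinates.\<close>
  let ?P = "\<lambda>i a b (\<sigma> :: 'e code). dist (past_point Q n x \<sigma> a) (past_point Q n x \<sigma> b) < inverse (real (Suc i))"
  have "?P i a b \<in> measurable past_algebra (count_space UNIV)" for i a b
  proof (rule measurable_past_coordinates[of "- int (max a b)"])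
    fix \<sigma> \<tau> :: "'e code" assume eq: "\<And>k. k \<in> {- int (max a b)..0} \<Longrightarrow> \<sigma> k = \<tau> k"
    have "past_point Q n x \<sigma> a = past_point Q n x \<tau> a" "past_point Q n x \<sigma> b = past_point Q n x \<tau> b"
      by (rule past_point_cong, rule eq, auto)+
    then show "?P i a b \<sigma> = ?P i a b \<tau>" by simp
  qed simp
  then have "{\<sigma> \<in> space past_algebra. ?P i a b \<sigma>} \<in> sets past_algebra" for i a b
    by (rule predE)
  then have "{\<sigma> \<in> space past_algebra. \<forall>i. \<exists>M. \<forall>a\<in>{M..}. \<forall>b\<in>{M<..}. ?P i a b \<sigma>} \<in> sets past_algebra"
    by (intro sets.sets_Collect_countable_All sets.sets_Collect_countable_Ex sets.sets_Collect_countable_Ball) auto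
  moreover have "convergent (past_point Q n x \<sigma>) \<longleftrightarrow> (\<forall>i. \<exists>M. \<forall>a\<in>{M..}. \<forall>b\<in>{M<..}. ?P i a b \<sigma>)" for \<sigma>
  proof -
    have "(\<forall>a\<ge>M. \<forall>b\<ge>M. ?P i a b \<sigma>) \<longrightarrow> (\<forall>a\<in>{M..}. \<forall>b\<in>{M<..}. ?P i a b \<sigma>)" for M i
      by auto
    \<comment> \<open>The range for \<open>b\<close> starts one later than that for
      \<open>a\<close>; raising the threshold to \<open>Suc M\<close> recovers the symmetric Cauchy
      condition.\<close>
    moreover have "(\<forall>a\<in>{M..}. \<forall>b\<in>{M<..}. ?P i a b \<sigma>) \<longrightarrow> (\<forall>a\<ge>Suc M. \<forall>b\<ge>Suc M. ?P i a b \<sigma>)" for M i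
      by auto
    ultimately have "Cauchy (past_point Q n x \<sigma>) \<longleftrightarrow> (\<forall>i. \<exists>M. \<forall>a\<in>{M..}. \<forall>b\<in>{M<..}. ?P i a b \<sigma>)"
      unfolding metric_Cauchy_iff2 by meson
    then show ?thesis by (simp add: Cauchy_convergent_iff)
  qed
  ultimately show ?thesis by simp
qed

lemma coding_dom_sets:
  fixes Q :: "('k::complete_space, 'e::countable, 'n) msys"
  shows "coding_dom Q n x \<in> sets code_borel"
proof -
  have "coding_dom Q n x = path_space Q n \<inter> {\<sigma>. convergent (past_point Q n x \<sigma>)}"
    by (auto simp: coding_dom_def)
  then show ?thesis
    by (simp add: sets.Int path_space_sets past_sets_code_borel[OF past_convergent_sets])
qed

text \<open>Unlike the coding map, whose domain \<open>coding_dom\<close> depends on all coordinates, this version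
  depends on the past only; both agree on \<open>coding_dom\<close>.\<close>

definition past_map :: "('k::metric_space, 'e, 'n) msys \<Rightarrow> 'n \<Rightarrow> ('n \<Rightarrow> 'k) \<Rightarrow> 'e code \<Rightarrow> 'k" where
  "past_map Q n x \<sigma> =
    (if convergent (past_point Q n x \<sigma>) then lim (past_point Q n x \<sigma>) else x n)"

lemma past_map_eq: "\<sigma> \<in> coding_dom Q n x \<Longrightarrow> past_map Q n x \<sigma> = coding_map Q n x \<sigma>"
  by (simp add: past_map_def coding_map_def coding_dom_def)

text \<open>Where there is no convergence the approximating sequence is frozen at the constant
  \<open>x n\<close>, so \<open>past_map\<close> is an everywhere pointwise limit of measurable maps
  into a metric space.\<close>

lemma past_map_measurable:
  fixes Q :: "('k::complete_space, 'e::countable, 'n) msys"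
  shows "past_map Q n x \<in> borel_measurable past_algebra"
proof (rule borel_measurable_LIMSEQ_metric)
  let ?f = "\<lambda>j \<sigma>. if convergent (past_point Q n x \<sigma>) then past_point Q n x \<sigma> j else x n"
  have "(\<lambda>\<sigma>. past_point Q n x \<sigma> j) \<in> borel_measurable past_algebra" for j
    by (rule measurable_past_coordinates[of "- int j"], rule past_point_cong) auto
  then show "?f j \<in> borel_measurable past_algebra" for j
    using past_convergent_sets[of Q n x] by (intro measurable_If) auto
  show "(\<lambda>j. ?f j \<sigma>) \<longlonglongrightarrow> past_map Q n x \<sigma>" for \<sigma>
    by (simp add: past_map_def convergent_LIMSEQ_iff)
qed

section \<open>Extended probabilities and the two classes of measures\<close>

context unif_cont_markov_system
begin

text \<open>Uniform continuity into the complete real line extends \<open>wprob\<close> to the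
  closure of its cell. This witness makes the choice in \<open>wprob_closure\<close>
  meaningful.\<close>

lemma wprob_closure_extension:
  obtains g where "continuous_on (closure (cell Q (isrc Q e))) g"
    "\<And>y. y \<in> cell Q (isrc Q e) \<Longrightarrow> g y = wprob Q e y"
    "\<And>y. wprob_closure Q e y = (if y \<in> closure (cell Q (isrc Q e)) then g y else 0)"
proof -
  let ?A = "cell Q (isrc Q e)"
  let ?P = "\<lambda>g. continuous_on (closure ?A) g \<and> (\<forall>z\<in>?A. g z = wprob Q e z)"
  obtain g where "uniformly_continuous_on (closure ?A) g" "\<And>y. y \<in> ?A \<Longrightarrow> wprob Q e y = g y"
    using uniformly_continuous_on_extension_on_closure[OF wprob_unif_cont] by metis
  then have "?P g"
    by (auto intro: uniformly_continuous_imp_continuous)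
  then have "?P (SOME g. ?P g)" by (rule someI[of ?P])
  then show ?thesis
    by (intro that[of "SOME g. ?P g"]) (auto simp: wprob_closure_def Let_def)
qed

lemma wprob_closure_measurable: "wprob_closure Q e \<in> borel_measurable borel"
proof -
  obtain g where g: "continuous_on (closure (cell Q (isrc Q e))) g"
    "\<And>y. wprob_closure Q e y = (if y \<in> closure (cell Q (isrc Q e)) then g y else 0)"
    by (rule wprob_closure_extension[of e]) auto
  have "(\<lambda>y. if y \<in> closure (cell Q (isrc Q e)) then g y else 0) \<in> borel_measurable borel"
    using g(1) by (intro borel_measurable_continuous_on_if) auto
  then show ?thesis by (simp add: g(2)[abs_def])
qed

text \<open>The interval [0,1] is closed, so the bounds pass from the cell to its closure by
  continuity.\<close>

lemma wprob_closure_range: "wprob_closure Q e y \<in> {0..1}"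
proof -
  obtain g where g: "continuous_on (closure (cell Q (isrc Q e))) g"
    "\<And>y. y \<in> cell Q (isrc Q e) \<Longrightarrow> g y = wprob Q e y"
    "\<And>y. wprob_closure Q e y = (if y \<in> closure (cell Q (isrc Q e)) then g y else 0)"
    by (rule wprob_closure_extension[of e]) auto
  have "g ` closure (cell Q (isrc Q e)) \<subseteq> {0..1}"
    using g(2) wprob_range by (intro image_closure_subset[OF g(1)]) auto
  then show ?thesis by (auto simp: g(3))
qed

lemma coding_measures_decomposition:
  assumes M: "M \<in> coding_measures Q n x" and L: "ergodic_decomposition M L"
  shows "AE \<omega> in M. L \<omega> \<in> coding_measures Q n x"
proof -
  have "AE \<omega> in M. L \<omega> \<in> shift_invariant \<and> measure (L \<omega>) (coding_dom Q n x) = 1 \<and>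
    (\<forall>e. AE \<sigma> in L \<omega>. real_cond_exp (L \<omega>) past_algebra (indicator (cylinder 1 1 (\<lambda>_. Some e))) \<sigma> =
      wprob Q e (coding_map Q n x \<sigma>))"
  proof (rule decomposition_coding[OF _ L coding_dom_sets, where u = "\<lambda>e \<sigma>. wprob Q e (past_map Q n x \<sigma>)"])
    show "(\<lambda>\<sigma>. wprob Q e (past_map Q n x \<sigma>)) \<in> borel_measurable past_algebra" for e
      by (rule measurable_compose[OF past_map_measurable wprob_measurable])
  qed (use M wprob_range in \<open>auto simp: coding_measures_def past_map_eq\<close>)
  then show ?thesis by (simp add: coding_measures_def)
qed

lemma coding_measures_closure_decomposition:
  assumes M: "M \<in> coding_measures_closure Q n x" and L: "ergodic_decomposition M L"
  shows "AE \<omega> in M. L \<omega> \<in> coding_measures_closure Q n x"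
proof -
  \<comment> \<open>Dropping the path condition from \<open>ends_at\<close> leaves a set that reads
    coordinate 0 only; nothing changes on \<open>coding_dom\<close>, which lies inside
    \<open>path_space\<close>.\<close>
  let ?T = "\<lambda>e. {\<sigma>. tgt_ext Q n (\<sigma> 0) = isrc Q e}"
  let ?u = "\<lambda>e \<sigma>. wprob_closure Q e (past_map Q n x \<sigma>) * indicator (?T e) \<sigma>"
  have "AE \<omega> in M. L \<omega> \<in> shift_invariant \<and> measure (L \<omega>) (coding_dom Q n x) = 1 \<and>
    (\<forall>e. AE \<sigma> in L \<omega>. real_cond_exp (L \<omega>) past_algebra (indicator (cylinder 1 1 (\<lambda>_. Some e))) \<sigma> =
      wprob_closure Q e (coding_map Q n x \<sigma>) * indicator (ends_at Q n (isrc Q e)) \<sigma>)"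
  proof (rule decomposition_coding[OF _ L coding_dom_sets, where u = ?u])
    show "?u e \<in> borel_measurable past_algebra" for e
    proof (intro borel_measurable_times)
      show "(\<lambda>\<sigma>. wprob_closure Q e (past_map Q n x \<sigma>)) \<in> borel_measurable past_algebra"
        by (rule measurable_compose[OF past_map_measurable wprob_closure_measurable])
      show "indicator (?T e) \<in> borel_measurable past_algebra"
        by (rule measurable_past_coordinates[of 0]) (auto simp: indicator_def)
    qed
    show "?u e \<sigma> \<in> {0..1}" for e \<sigma>
      using wprob_closure_range[of e "past_map Q n x \<sigma>"] by (auto simp: indicator_def)
    show "?u e \<sigma> = wprob_closure Q e (coding_map Q n x \<sigma>) * indicator (ends_at Q n (isrc Q e)) \<sigma>"
      if "\<sigma> \<in> coding_dom Q n x" for e \<sigma>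
      using that by (simp add: past_map_eq) (auto simp: coding_dom_def ends_at_def indicator_def)
  qed (use M in \<open>auto simp: coding_measures_closure_def\<close>)
  then show ?thesis by (simp add: coding_measures_closure_def)
qed

end


theorem corollary1:
  fixes Q :: "('k::complete_space, 'e::countable, 'n) msys"
    and n_inf :: 'n
    and x :: "'n \<Rightarrow> 'k"
    and M :: "'e code measure"
    and L :: "'e code \<Rightarrow> 'e code measure"
  assumes "unif_cont_markov_system Q"
    and "\<And>i. x i \<in> cell Q i"
    and "M \<in> shift_invariant"
    and "ergodic_decomposition M L"
  shows "(M \<in> coding_measures Q n_inf x \<longrightarrow>
            (AE \<omega> in M. L \<omega> \<in> coding_measures Q n_inf x)) \<and>
         (M \<in> coding_measures_closure Q n_inf x \<longrightarrow>
            (AE \<omega> in M. L \<omega> \<in> coding_measures_closure Q n_inf x))"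
proof -
  interpret unif_cont_markov_system Q by fact
  show ?thesis
    using coding_measures_decomposition coding_measures_closure_decomposition assms(4) by blast
qed

end
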